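(* For every $K_6$-free finite simple graph $G$ on $n$ vertices, $\tau_{B}(G) \le \frac{17 n^2}{100}$.
   Context: All graphs are finite, simple and undirected. $\tau_{B}(G)$ denotes the minimum size of a set of edges whose deletion from $G$ leaves a bipartite graph. $K_6$-free means $G$ contains no complete subgraph on $6$ vertices. *)

theory Defs
  imports Complex_Main "HOL-Library.Ramsey"
begin

text \<open>A graph is given by its vertex set \<open>V\<close> and its set \<open>E\<close> of edges, which are two-element
  subsets of \<open>V\<close>.\<close>

definition finite_simple_graph :: "'a set \<Rightarrow> 'a set set \<Rightarrow> bool" where
  "finite_simple_graph V E \<longleftrightarrow> finite V \<and> E \<subseteq> nsets V 2"

definition clique_free :: "nat \<Rightarrow> 'a set \<Rightarrow> 'a set set \<Rightarrow> bool" where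
  "clique_free r V E \<longleftrightarrow> \<not> (\<exists>K\<in>nsets V r. clique K E)"

definition bipartite :: "'a set \<Rightarrow> 'a set set \<Rightarrow> bool" where
  "bipartite V E \<longleftrightarrow>
     (\<exists>A B. A \<union> B = V \<and> A \<inter> B = {} \<and> (\<forall>e\<in>E. \<exists>a\<in>A. \<exists>b\<in>B. e = {a, b}))"

definition tau_B :: "'a set \<Rightarrow> 'a set set \<Rightarrow> nat" where
  "tau_B V E = (LEAST k. \<exists>F\<subseteq>E. finite F \<and> card F = k \<and> bipartite V (E - F))"

text \<open>The minimum is attained, so \<open>LEAST\<close> is not a junk value.\<close>

lemma tau_B_attained:
  assumes "finite_simple_graph V E"
  shows "\<exists>F\<subseteq>E. finite F \<and> card F = tau_B V E \<and> bipartite V (E - F)"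
  unfolding tau_B_def
proof (rule LeastI)
  have "finite E"
    using assms finite_subset finite_imp_finite_nsets
    unfolding finite_simple_graph_def by blast
  moreover have "bipartite V (E - E)"
    unfolding bipartite_def by auto
  ultimately show "\<exists>F\<subseteq>E. finite F \<and> card F = card E \<and> bipartite V (E - F)"
    by blast
qed

end

theory Submission
  imports Defs
begin

text \<open>
  Write \<open>e\<close> for the number of edges. In a \<open>K\<^sub>6\<close>-free graph, fix a vertex \<open>v\<close> and make its
  non-neighbours one colour class. Its neighbourhood is \<open>K\<^sub>5\<close>-free, so Fueredi's argument
  (peel off the non-neighbours of a vertex of maximum degree, repeatedly) splits it into four
  classes such that the edges of the neighbourhood, those inside the classes counted twice, number
  at most \<open>3/8 d(v)\<^sup>2\<close>. Averaging over \<open>v\<close> yields a five-class partition with \<open>m\<close> edges inside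
  the classes, where \<open>e + m \<le> 2 e - 5/2 e\<^sup>2/n\<^sup>2\<close>. Merging the classes two against three, in the
  best of ten ways, leaves at most \<open>m + 2/5 (e - m) \<le> e - 3/2 e\<^sup>2/n\<^sup>2 \<le> n\<^sup>2/6\<close> edges uncut.
\<close>

section \<open>Counting adjacent ordered pairs\<close>

text \<open>All edge counts below are over ordered pairs, so edges within a set are counted twice.\<close>

definition pairs :: "('a \<Rightarrow> 'a \<Rightarrow> bool) \<Rightarrow> 'a set \<Rightarrow> 'a set \<Rightarrow> real" where
  "pairs R A B = (\<Sum>u\<in>A. \<Sum>w\<in>B. of_bool (R u w))"

definition mono_pairs :: "('a \<Rightarrow> 'a \<Rightarrow> bool) \<Rightarrow> 'a set \<Rightarrow> ('a \<Rightarrow> 'b) \<Rightarrow> real" where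
  "mono_pairs R V f = pairs (\<lambda>u w. R u w \<and> f u = f w) V V"

definition nbhd :: "('a \<Rightarrow> 'a \<Rightarrow> bool) \<Rightarrow> 'a set \<Rightarrow> 'a \<Rightarrow> 'a set" where
  "nbhd R V v = {w\<in>V. R v w}"

definition no_clique :: "nat \<Rightarrow> ('a \<Rightarrow> 'a \<Rightarrow> bool) \<Rightarrow> 'a set \<Rightarrow> bool" where
  "no_clique r R V \<longleftrightarrow>
     \<not> (\<exists>K\<subseteq>V. finite K \<and> card K = r \<and> (\<forall>x\<in>K. \<forall>y\<in>K. x \<noteq> y \<longrightarrow> R x y))"

lemma pairs_Un_left:
  assumes "finite A" "finite A'" "A \<inter> A' = {}"
  shows "pairs R (A \<union> A') B = pairs R A B + pairs R A' B"
  unfolding pairs_def using assms by (rule sum.union_disjoint)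

lemma pairs_Un_right:
  assumes "finite B" "finite B'" "B \<inter> B' = {}"
  shows "pairs R A (B \<union> B') = pairs R A B + pairs R A B'"
  unfolding pairs_def using assms by (simp add: sum.union_disjoint sum.distrib del: sum_of_bool_eq)

lemma pairs_commute:
  assumes "symp R"
  shows "pairs R A B = pairs R B A"
proof -
  have "R u w = R w u" for u w
    using sympD[OF assms] by blast
  then show ?thesis
    unfolding pairs_def by (subst sum.swap) (intro sum.cong refl arg_cong[where f = of_bool])
qed

lemma pairs_cong:
  assumes "\<And>u w. u \<in> A \<Longrightarrow> w \<in> B \<Longrightarrow> R u w = R' u w"
  shows "pairs R A B = pairs R' A B"
  unfolding pairs_def using assms by (simp cong: sum.cong)

lemma pairs_eq_sum_card_nbhd:
  assumes "finite V"
  shows "pairs R A V = (\<Sum>u\<in>A. real (card (nbhd R V u)))"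
proof -
  have "(\<Sum>w\<in>V. of_bool (R u w)) = real (card (nbhd R V u))" for u
    using assms by (simp add: nbhd_def sum.If_cases of_bool_def Int_def)
  then show ?thesis
    by (simp add: pairs_def)
qed

lemma pairs_eq_card:
  assumes "finite A" "finite B"
  shows "pairs R A B = real (card {(u, w) \<in> A \<times> B. R u w})"
proof -
  have "pairs R A B = (\<Sum>p\<in>A \<times> B. of_bool (case p of (u, w) \<Rightarrow> R u w))"
    by (simp add: pairs_def sum.cartesian_product case_prod_unfold)
  also have "\<dots> = real (card ((A \<times> B) \<inter> {p. case p of (u, w) \<Rightarrow> R u w}))"
    using assms by (simp add: of_bool_def sum.If_cases)
  also have "(A \<times> B) \<inter> {p. case p of (u, w) \<Rightarrow> R u w} = {(u, w) \<in> A \<times> B. R u w}"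
    by auto
  finally show ?thesis .
qed

section \<open>Colourings of clique-free graphs with few monochromatic edges\<close>

lemma no_clique_nbhd:
  assumes "no_clique (Suc r) R V" "symp R" "\<And>x. \<not> R x x" "v \<in> V"
  shows "no_clique r R (nbhd R V v)"
  unfolding no_clique_def
proof
  assume "\<exists>K\<subseteq>nbhd R V v. finite K \<and> card K = r \<and> (\<forall>x\<in>K. \<forall>y\<in>K. x \<noteq> y \<longrightarrow> R x y)"
  then obtain K where K: "K \<subseteq> nbhd R V v" "finite K" "card K = r"
    "\<forall>x\<in>K. \<forall>y\<in>K. x \<noteq> y \<longrightarrow> R x y" by blast
  have "v \<notin> K"
    using K(1) assms(3) by (auto simp: nbhd_def)
  moreover have "R v x" "R x v" if "x \<in> K" for x
    using K(1) that sympD[OF assms(2)] by (auto simp: nbhd_def)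
  ultimately have "insert v K \<subseteq> V \<and> finite (insert v K) \<and> card (insert v K) = Suc r \<and>
      (\<forall>x\<in>insert v K. \<forall>y\<in>insert v K. x \<noteq> y \<longrightarrow> R x y)"
    using K assms(4) by (auto simp: nbhd_def)
  then show False
    using assms(1) unfolding no_clique_def by blast
qed

text \<open>As \<open>g\<close> stays below \<open>p\<close>, the fresh colour makes all pairs
  inside \<open>V - N\<close> monochromatic and no pair across. So the left side counts the pairs
  inside \<open>V - N\<close> twice, and by symmetry the two directions across also amount to twice
  those leaving \<open>V - N\<close>. Together they form a doubled degree sum over
  \<open>V - N\<close>.\<close>

lemma extend_colouring_by_complement:
  fixes g :: "'a \<Rightarrow> nat"
  assumes "finite V" "N \<subseteq> V" "symp R" "\<And>u. u \<in> N \<Longrightarrow> g u < p"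
  defines "f \<equiv> \<lambda>u. if u \<in> N then g u else p"
  shows "pairs R V V + mono_pairs R V f =
           2 * pairs R (V - N) V + pairs R N N + mono_pairs R N g"
proof -
  let ?W = "V - N" and ?Q = "\<lambda>u w. R u w \<and> f u = f w"
  have fin: "finite N" "finite ?W" and disj: "N \<inter> ?W = {}" and V: "V = N \<union> ?W"
    using assms(1,2) finite_subset by auto
  have decomp: "pairs S V V = pairs S N N + pairs S N ?W + pairs S ?W N + pairs S ?W ?W" for S
    using pairs_Un_left[OF fin disj, of S V] pairs_Un_right[OF fin disj, of S N]
      pairs_Un_right[OF fin disj, of S ?W] V by simp
  have right: "pairs R ?W V = pairs R ?W N + pairs R ?W ?W"
    using pairs_Un_right[OF fin disj, of R ?W] V by simp
  have "pairs ?Q N N = mono_pairs R N g" "pairs ?Q ?W ?W = pairs R ?W ?W"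
    unfolding mono_pairs_def by (rule pairs_cong; simp add: f_def)+
  moreover have "pairs ?Q N ?W = pairs (\<lambda>_ _. False) N ?W"
    "pairs ?Q ?W N = pairs (\<lambda>_ _. False) ?W N"
    by (rule pairs_cong; use assms(4) in \<open>force simp: f_def\<close>)+
  ultimately have "mono_pairs R V f = mono_pairs R N g + pairs R ?W ?W"
    unfolding mono_pairs_def[of R V] decomp[of ?Q] by (simp add: pairs_def)
  then show ?thesis
    using decomp[of R] right pairs_commute[OF assms(3), of N ?W] by simp
qed

text \<open>This is Turan's bound with the monochromatic pairs added on the left: how far a graph
  falls short of the Turan number limits how far it is from being \<open>p + 1\<close>-partite.
  Induction applies because neighbourhoods lose one clique size.\<close>

lemma clique_free_colouring:
  assumes "finite V" "symp R" "\<And>x. \<not> R x x" "no_clique (Suc (Suc p)) R V"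
  shows "\<exists>f :: 'a \<Rightarrow> nat. (\<forall>u\<in>V. f u < Suc p) \<and>
           real (Suc p) * (pairs R V V + mono_pairs R V f) \<le> real p * (real (card V))\<^sup>2"
  using assms(1,4)
proof (induction p arbitrary: V)
  case 0
  have noedge: "\<not> R u w" if "u \<in> V" "w \<in> V" for u w
  proof
    assume "R u w"
    moreover from this have "u \<noteq> w" "R w u"
      using assms(3) sympD[OF assms(2)] by auto
    ultimately have "{u, w} \<subseteq> V \<and> finite {u, w} \<and> card {u, w} = Suc (Suc 0) \<and>
        (\<forall>x\<in>{u, w}. \<forall>y\<in>{u, w}. x \<noteq> y \<longrightarrow> R x y)"
      using that by auto
    then show False
      using 0 unfolding no_clique_def by blast
  qed
  then show ?case
    by (intro exI[of _ "\<lambda>_. 0"]) (simp add: pairs_def mono_pairs_def)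
next
  case (Suc p)
  show ?case
  proof (cases "V = {}")
    case True
    then show ?thesis by (simp add: pairs_def mono_pairs_def)
  next
    case False
    let ?d = "\<lambda>u. card (nbhd R V u)"
    have "Max (?d ` V) \<in> ?d ` V"
      using False Suc.prems(1) by (intro Max_in) auto
    then obtain v where "v \<in> V" "Max (?d ` V) = ?d v"
      by blast
    moreover from this have "?d u \<le> ?d v" if "u \<in> V" for u
      using Max_ge[of "?d ` V" "?d u"] Suc.prems(1) that by simp
    ultimately have v: "v \<in> V" "\<And>u. u \<in> V \<Longrightarrow> ?d u \<le> ?d v"
      by blast+
    let ?N = "nbhd R V v"
    have N: "?N \<subseteq> V" "finite ?N"
      using Suc.prems(1) by (auto simp: nbhd_def)
    obtain g :: "'a \<Rightarrow> nat" where g: "\<And>u. u \<in> ?N \<Longrightarrow> g u < Suc p"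
      "real (Suc p) * (pairs R ?N ?N + mono_pairs R ?N g) \<le> real p * (real (?d v))\<^sup>2"
      using Suc.IH[OF N(2) no_clique_nbhd[OF Suc.prems(2) assms(2,3) v(1)]] by blast
    define f where "f = (\<lambda>u. if u \<in> ?N then g u else Suc p)"
    \<comment> \<open>Maximality of the degree of \<open>v\<close> enters here: it bounds every term
      of the degree sum over the non-neighbours.\<close>
    have "pairs R (V - ?N) V \<le> (\<Sum>u\<in>V - ?N. real (?d v))"
      unfolding pairs_eq_sum_card_nbhd[OF Suc.prems(1)] by (rule sum_mono) (simp add: v(2))
    also have "\<dots> = (real (card V) - real (?d v)) * real (?d v)"
      using N Suc.prems(1) by (simp add: card_Diff_subset card_mono of_nat_diff)
    finally have W: "pairs R (V - ?N) V \<le> (real (card V) - real (?d v)) * real (?d v)" .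
    define n d q T where "n = real (card V)" and "d = real (?d v)" and "q = real (Suc p)"
      and "T = pairs R V V + mono_pairs R V f"
    have q: "q > 0" "real p = q - 1" "real (Suc (Suc p)) = q + 1"
      by (auto simp: q_def)
    have "T = 2 * pairs R (V - ?N) V + (pairs R ?N ?N + mono_pairs R ?N g)"
      unfolding T_def f_def
      using extend_colouring_by_complement[OF Suc.prems(1) N(1) assms(2) g(1)] by simp
    then have "q * T \<le> q * (2 * ((n - d) * d)) + (q - 1) * d\<^sup>2"
      using W g(2) q(1) unfolding n_def[symmetric] d_def[symmetric] q_def[symmetric] q(2)
      by (smt (verit) distrib_left mult_left_mono)
    \<comment> \<open>The factor \<open>q + 1\<close> completes the square in \<open>d\<close>; the
      square vanishes at the Turan degree \<open>d = q * n / (q + 1)\<close>.\<close>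
    then have "(q + 1) * (q * T) \<le> (q + 1) * (q * (2 * ((n - d) * d)) + (q - 1) * d\<^sup>2)"
      using q(1) by (intro mult_left_mono) auto
    also have "\<dots> = (q * n)\<^sup>2 - (q * n - (q + 1) * d)\<^sup>2"
      by (simp add: power2_eq_square algebra_simps)
    also have "\<dots> \<le> q * (q * n\<^sup>2)"
      by (simp add: power_mult_distrib power2_eq_square[of q] mult.assoc)
    finally have "q * ((q + 1) * T) \<le> q * (q * n\<^sup>2)"
      by (simp add: mult.left_commute)
    then have "(q + 1) * T \<le> q * n\<^sup>2"
      using q(1) by simp
    moreover have "\<forall>u\<in>V. f u < Suc (Suc p)"
      using g(1) by (auto simp: f_def less_SucI)
    ultimately show ?thesis
      unfolding q(3)[unfolded q_def] T_def n_def q_def by (intro exI[of _ f] conjI)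
  qed
qed

section \<open>Five-colourings by averaging over the first vertex\<close>

lemma K6_free_colouring:
  assumes "finite V" "symp R" "\<And>x. \<not> R x x" "no_clique 6 R V" "V \<noteq> {}"
  shows "\<exists>f :: 'a \<Rightarrow> nat. (\<forall>u\<in>V. f u < 5) \<and>
           mono_pairs R V f \<le> pairs R V V - 5 / 4 * (pairs R V V)\<^sup>2 / (real (card V))\<^sup>2"
proof -
  let ?d = "\<lambda>u. real (card (nbhd R V u))"
  define n where "n = real (card V)"
  define M where "M = pairs R V V"
  \<comment> \<open>\<open>b v\<close> bounds \<open>M + mono_pairs R V f\<close> for the colouring
    \<open>f\<close> built from \<open>v\<close>; \<open>3 / 4\<close> is the bound of
    \<open>clique_free_colouring\<close> for \<open>p = 3\<close>.\<close>
  define b where "b = (\<lambda>v. 2 * pairs R (V - nbhd R V v) V + 3 / 4 * (?d v)\<^sup>2)"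
  have n: "n > 0"
    using assms(1,5) by (simp add: n_def card_gt_0_iff)
  have M_deg: "M = (\<Sum>v\<in>V. ?d v)"
    unfolding M_def by (rule pairs_eq_sum_card_nbhd[OF assms(1)])
  have compl: "pairs R (V - nbhd R V v) V = M - (\<Sum>u\<in>V. of_bool (R v u) * ?d u)" for v
  proof -
    have "M = pairs R (V - nbhd R V v) V + pairs R (nbhd R V v) V"
      unfolding M_def using assms(1)
      by (subst pairs_Un_left[symmetric])
        (auto simp: nbhd_def intro!: arg_cong2[of _ _ _ _ "\<lambda>A. pairs R A"])
    moreover have "pairs R (nbhd R V v) V = (\<Sum>u\<in>V. of_bool (R v u) * ?d u)"
      unfolding pairs_eq_sum_card_nbhd[OF assms(1)]
      using assms(1)
      by (simp add: nbhd_def sum.inter_filter of_bool_def if_distrib if_distribR cong: if_cong)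
    ultimately show ?thesis by simp
  qed
  have Rc: "(of_bool (R v u) :: real) = of_bool (R u v)" for u v
    using sympD[OF assms(2), of u v] sympD[OF assms(2), of v u] by (simp add: of_bool_def)
  \<comment> \<open>Each degree is counted once per neighbour: both sides count walks with two
    edges.\<close>
  have "(\<Sum>v\<in>V. \<Sum>u\<in>V. of_bool (R v u) * ?d u) = (\<Sum>u\<in>V. ?d u * (\<Sum>v\<in>V. of_bool (R u v)))"
    unfolding sum_distrib_left by (subst sum.swap) (simp add: Rc mult.commute)
  also have "\<dots> = (\<Sum>u\<in>V. (?d u)\<^sup>2)"
    using pairs_eq_sum_card_nbhd[OF assms(1), of R "{_}"]
    by (simp add: pairs_def power2_eq_square)
  finally have walks: "(\<Sum>v\<in>V. \<Sum>u\<in>V. of_bool (R v u) * ?d u) = (\<Sum>u\<in>V. (?d u)\<^sup>2)" .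
  \<comment> \<open>Cauchy-Schwarz, as nonnegativity of the variance of the degrees around their
    mean \<open>M / n\<close>.\<close>
  have "0 \<le> (\<Sum>u\<in>V. (?d u - M / n)\<^sup>2)"
    by (simp add: sum_nonneg)
  also have "\<dots> = (\<Sum>u\<in>V. (?d u)\<^sup>2) - 2 * (M / n) * M + n * (M / n)\<^sup>2"
    unfolding power2_diff
    by (simp add: sum.distrib sum_subtractf M_deg n_def mult_ac
        flip: sum_distrib_left sum_distrib_right sum_divide_distrib)
  also have "\<dots> = (\<Sum>u\<in>V. (?d u)\<^sup>2) - M\<^sup>2 / n"
    using n by (simp add: power2_eq_square)
  finally have cs: "M\<^sup>2 / n \<le> (\<Sum>u\<in>V. (?d u)\<^sup>2)"
    by simp
  \<comment> \<open>The coefficient is \<open>- 2 + 3 / 4\<close>. Being negative, it turns the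
    lower bound on the squared degrees into an upper bound on the average of
    \<open>b\<close>.\<close>
  have "(\<Sum>v\<in>V. b v) = 2 * n * M - 5 / 4 * (\<Sum>u\<in>V. (?d u)\<^sup>2)"
    unfolding b_def compl
    by (simp add: sum.distrib sum_subtractf walks n_def
        flip: sum_distrib_left sum_divide_distrib)
  also have "\<dots> \<le> (\<Sum>v\<in>V. 2 * M - 5 / 4 * M\<^sup>2 / n\<^sup>2)"
    using cs n by (simp add: n_def[symmetric] field_simps power2_eq_square)
  finally obtain v where v: "v \<in> V" "b v \<le> 2 * M - 5 / 4 * M\<^sup>2 / n\<^sup>2"
    using sum_strict_mono[OF assms(1,5), of "\<lambda>_. 2 * M - 5 / 4 * M\<^sup>2 / n\<^sup>2" b] by fastforce
  let ?N = "nbhd R V v"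
  have N: "?N \<subseteq> V" "finite ?N"
    using assms(1) by (auto simp: nbhd_def)
  have "no_clique (Suc (Suc 3)) R ?N"
    using no_clique_nbhd[of 5 R V v] assms(2-4) v(1) by simp
  then obtain g :: "'a \<Rightarrow> nat" where g: "\<And>u. u \<in> ?N \<Longrightarrow> g u < 4"
    "4 * (pairs R ?N ?N + mono_pairs R ?N g) \<le> 3 * (?d v)\<^sup>2"
    using clique_free_colouring[OF N(2) assms(2,3), of 3] by auto
  define f where "f = (\<lambda>u. if u \<in> ?N then g u else 4)"
  have "M + mono_pairs R V f = 2 * pairs R (V - ?N) V + pairs R ?N ?N + mono_pairs R ?N g"
    unfolding M_def f_def
    by (rule extend_colouring_by_complement[OF assms(1) N(1) assms(2) g(1)])
  then have "mono_pairs R V f \<le> M - 5 / 4 * M\<^sup>2 / n\<^sup>2"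
    using g(2) v(2) unfolding b_def by argo
  moreover have "\<forall>u\<in>V. f u < 5"
    using g(1) by (fastforce simp: f_def)
  ultimately show ?thesis
    unfolding M_def n_def by blast
qed

section \<open>Merging five classes into two\<close>

definition two_subsets_of_five :: "nat set list" where
  "two_subsets_of_five =
     [{0,1}, {0,2}, {0,3}, {0,4}, {1,2}, {1,3}, {1,4}, {2,3}, {2,4}, {3,4}]"

text \<open>Two distinct colours are separated by the \<open>2 * 3\<close> sets that contain exactly
  one of them, which leaves 4 of the ten; equal colours are never separated.\<close>

lemma two_subsets_of_five_not_separating:
  assumes "i < 5" "j < 5"
  shows "(\<Sum>S\<leftarrow>two_subsets_of_five. of_bool (i \<in> S \<longleftrightarrow> j \<in> S)) = (4 + 6 * of_bool (i = j) :: real)"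
proof -
  have "i \<in> {0,1,2,3,4}" "j \<in> {0,1,2,3,4}"
    using assms by auto
  then show ?thesis
    by (elim insertE emptyE; simp add: two_subsets_of_five_def)
qed

text \<open>Summed over the ten splits, a monochromatic pair stays uncut ten times and any other
  pair four times. The best split does no worse than the average.\<close>

lemma five_colouring_cut:
  assumes "\<And>u. u \<in> V \<Longrightarrow> f u < (5::nat)"
  shows "\<exists>S. 10 * pairs (\<lambda>u w. R u w \<and> (f u \<in> S \<longleftrightarrow> f w \<in> S)) V V
             \<le> 4 * pairs R V V + 6 * mono_pairs R V f"
proof (rule ccontr)
  let ?c = "\<lambda>S. pairs (\<lambda>u w. R u w \<and> (f u \<in> S \<longleftrightarrow> f w \<in> S)) V V"
  let ?t = "4 * pairs R V V + 6 * mono_pairs R V f"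
  assume "\<not> ?thesis"
  then have less: "?t < 10 * ?c S" for S
    by (auto simp: not_le)
  have "(\<Sum>S\<leftarrow>two_subsets_of_five. ?c S) =
      (\<Sum>u\<in>V. \<Sum>w\<in>V. of_bool (R u w) * (\<Sum>S\<leftarrow>two_subsets_of_five. of_bool (f u \<in> S \<longleftrightarrow> f w \<in> S)))"
    by (simp add: two_subsets_of_five_def pairs_def of_bool_conj sum.distrib distrib_left)
  also have "\<dots> = (\<Sum>u\<in>V. \<Sum>w\<in>V. of_bool (R u w) * (4 + 6 * of_bool (f u = f w)))"
    using assms by (intro sum.cong refl) (simp add: two_subsets_of_five_not_separating)
  also have "\<dots> = ?t"
    by (simp add: mono_pairs_def pairs_def of_bool_conj sum.distrib distrib_left
        sum_distrib_left mult.left_commute mult.commute)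
  finally have "(\<Sum>S\<leftarrow>two_subsets_of_five. ?c S) = ?t" .
  moreover have "(\<Sum>S\<leftarrow>two_subsets_of_five. ?t) < (\<Sum>S\<leftarrow>two_subsets_of_five. 10 * ?c S)"
    by (rule sum_list_strict_mono) (auto simp: two_subsets_of_five_def intro: less)
  ultimately show False
    by (simp add: sum_list_const_mult two_subsets_of_five_def sum_list_triv)
qed

section \<open>From uncut pairs to edge deletions\<close>

lemma tau_B_le_uncut:
  assumes "finite_simple_graph V E"
  shows "2 * real (tau_B V E) \<le> pairs (\<lambda>u w. {u, w} \<in> E \<and> (u \<in> A \<longleftrightarrow> w \<in> A)) V V"
proof -
  \<comment> \<open>Deleting the edges that lie on one side of the cut leaves a bipartite graph.
    \<open>A\<close> may reach outside \<open>V\<close>, so the colour classes below are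
    \<open>V \<inter> A\<close> and \<open>V - A\<close>.\<close>
  define F where "F = {e \<in> E. e \<subseteq> A \<or> e \<inter> A = {}}"
  have V: "finite V" and "E \<subseteq> nsets V 2"
    using assms by (auto simp: finite_simple_graph_def)
  have E: "\<exists>u w. e = {u, w} \<and> u \<noteq> w \<and> u \<in> V \<and> w \<in> V" if "e \<in> E" for e
  proof -
    have "e \<subseteq> V" "card e = 2"
      using \<open>E \<subseteq> nsets V 2\<close> that by (auto simp: nsets_def)
    then show ?thesis
      by (auto simp: card_2_iff)
  qed
  have "finite E"
    using assms finite_subset finite_imp_finite_nsets
    unfolding finite_simple_graph_def by blast
  then have F: "F \<subseteq> E" "finite F"
    by (auto simp: F_def)
  have "\<exists>a\<in>V \<inter> A. \<exists>b\<in>V - A. e = {a, b}" if "e \<in> E - F" for e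
    using E[of e] that by (auto simp: F_def)
  then have "bipartite V (E - F)"
    unfolding bipartite_def by (intro exI[of _ "V \<inter> A"] exI[of _ "V - A"]) auto
  then have "tau_B V E \<le> card F"
    unfolding tau_B_def using F by (intro Least_le) blast
  \<comment> \<open>Every edge has two distinct ends, hence two orderings; the fibres over different
    edges are disjoint.\<close>
  moreover have "2 * card F = card {(u, w) \<in> V \<times> V. {u, w} \<in> E \<and> (u \<in> A \<longleftrightarrow> w \<in> A)}"
  proof -
    have "{(u, w) \<in> V \<times> V. {u, w} \<in> E \<and> (u \<in> A \<longleftrightarrow> w \<in> A)} = (\<Union>e\<in>F. {(u, w). {u, w} = e})"
      using E by (fastforce simp: F_def doubleton_eq_iff)
    moreover have "card {(u, w). {u, w} = e} = 2 \<and> finite {(u, w). {u, w} = e}" if "e \<in> F" for e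
    proof -
      obtain u w where "e = {u, w}" "u \<noteq> w"
        using E[of e] F(1) \<open>e \<in> F\<close> by blast
      then have "{(u, w). {u, w} = e} = {(u, w), (w, u)}" "(u, w) \<noteq> (w, u)"
        by (auto simp: doubleton_eq_iff)
      then show ?thesis
        by simp
    qed
    ultimately show ?thesis
      using card_UN_disjoint[OF F(2), of "\<lambda>e. {(u, w). {u, w} = e}"] by fastforce
  qed
  ultimately show ?thesis
    using V by (simp add: pairs_eq_card)
qed

section \<open>Optimising over the number of edges\<close>

theorem theorem4p10:
  fixes V :: "'a set" and E :: "'a set set" and n :: nat
  assumes "finite_simple_graph V E"
    and "card V = n"
    and "clique_free 6 V E"
  shows "real (tau_B V E) \<le> 17 * (real n)\<^sup>2 / 100"
proof (cases "V = {}")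
  case True
  then show ?thesis
    using tau_B_le_uncut[OF assms(1), of "{}"] by (simp add: pairs_def)
next
  case False
  define R where "R = (\<lambda>u w. {u, w} \<in> E)"
  have V: "finite V" and irrefl: "\<And>x. \<not> R x x" and sym: "symp R"
    using assms(1) unfolding finite_simple_graph_def R_def nsets_def symp_def
    by (auto simp: insert_commute)
  have "no_clique 6 R V"
    using assms(3) by (simp add: clique_free_def no_clique_def R_def nsets_def clique_def Bex_def)
  then obtain f :: "'a \<Rightarrow> nat" where f: "\<And>u. u \<in> V \<Longrightarrow> f u < 5"
    "mono_pairs R V f \<le> pairs R V V - 5 / 4 * (pairs R V V)\<^sup>2 / (real n)\<^sup>2"
    using K6_free_colouring[OF V sym irrefl _ False] unfolding assms(2) by blast
  obtain S where S: "10 * pairs (\<lambda>u w. R u w \<and> (f u \<in> S \<longleftrightarrow> f w \<in> S)) V V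
      \<le> 4 * pairs R V V + 6 * mono_pairs R V f"
    using five_colouring_cut[where V = V and f = f and R = R] f(1) by auto
  have "2 * real (tau_B V E) \<le> pairs (\<lambda>u w. R u w \<and> (f u \<in> S \<longleftrightarrow> f w \<in> S)) V V"
    using tau_B_le_uncut[OF assms(1), of "{u. f u \<in> S}"] by (simp add: R_def)
  then have tau: "real (tau_B V E) \<le> pairs R V V / 2 - 3 / 8 * ((pairs R V V)\<^sup>2 / (real n)\<^sup>2)"
    using S f(2) by simp
  have "real n > 0"
    using False V assms(2) by (auto simp: card_gt_0_iff)
  \<comment> \<open>Complete the square in the average degree; the worst case is
    \<open>2 / 3 * n\<close>, with value \<open>n^2 / 6\<close>, and
    \<open>1 / 6 < 17 / 100\<close>.\<close>
  then have "pairs R V V / 2 - 3 / 8 * ((pairs R V V)\<^sup>2 / (real n)\<^sup>2)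
      = (real n)\<^sup>2 / 6 - 3 / 8 * (pairs R V V / real n - 2 / 3 * real n)\<^sup>2"
    by (simp add: field_simps power2_eq_square)
  also have "\<dots> \<le> (real n)\<^sup>2 / 6"
    by simp
  also have "\<dots> \<le> 17 * (real n)\<^sup>2 / 100"
    by simp
  finally show ?thesis
    using tau by linarith
qed

end
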